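(* Every derivation in $\mathsf{G3Kt}$ of a labeled polytree sequent $\mathcal{R},\Gamma$ is effectively relatable to a derivation of $\mathfrak{N}(\mathcal{R},\Gamma)$ in $\textsf{SKT}$.
   Context: Tense formulae: $A ::= p \mid \overline{p} \mid A\wedge A \mid A\vee A \mid \Box A \mid \Diamond A \mid \blacksquare A \mid \Diamond^{-}A$, with $\Diamond^{-}$ the past diamond. Labeled sequents $\mathcal{R},\Gamma$ (relational atoms $Rxy$, labeled formulae $x:A$); a labeled polytree sequent is one whose graph (labels as vertices, edge $(x,y)$ for $Rxy$) has a tree as underlying undirected graph. $\mathsf{G3Kt}$ has rules: $(\textsf{id})$ $\mathcal{R},x:p,x:\overline{p},\Gamma$; $(\vee)$,$(\wedge)$ labelwise; $(\Box)$ from $\mathcal{R},Rxy,y:A,\Gamma$ infer $\mathcal{R},x:\Box A,\Gamma$ ($y$ fresh); $(\Diamond)$ from $\mathcal{R},Rxy,y:A,x:\Diamond A,\Gamma$ infer $\mathcal{R},Rxy,x:\Diamond A,\Gamma$; $(\blacksquare)$ from $\mathcal{R},Ryx,y:A,\Gamma$ infer $\mathcal{R},x:\blacksquare A,\Gamma$ ($y$ fresh); $(\Diamond^{-})$ from $\mathcal{R},Ryx,y:A,x:\Diamond^{-}A,\Gamma$ infer $\mathcal{R},Ryx,x:\Diamond^{-}A,\Gamma$. Nested sequents: $X ::= \varepsilon \mid A \mid X,X \mid \circ\{X\} \mid \bullet\{X\}$. $\textsf{SKT}$ has $(\textsf{id})$ $X,p,\overline{p}$; $(\vee)$; $(\wedge)$;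 contraction; weakening; display rules $(\textsf{rf})$ from $X,\circ\{Y\}$ infer $\bullet\{X\},Y$ and $(\textsf{rp})$ from $X,\bullet\{Y\}$ infer $\circ\{X\},Y$; $(\blacksquare)$ from $X,\bullet\{A\}$ infer $X,\blacksquare A$; $(\Box)$ from $X,\circ\{A\}$ infer $X,\Box A$; $(\Diamond^{-})$ from $X,\bullet\{Y,A\},\Diamond^{-}A$ infer $X,\bullet\{Y\},\Diamond^{-}A$; $(\Diamond)$ from $X,\circ\{Y,A\},\Diamond A$ infer $X,\circ\{Y\},\Diamond A$. $\mathfrak{N}$ translates a labeled polytree sequent to a nested sequent: starting from a label $x$, it puts the formulae labeled $x$ at top level and recursively nests the subtree through each $Rxy$ under $\circ\{\cdot\}$ and through each $Rzx$ under $\bullet\{\cdot\}$ (different starting labels give display-equivalent results). "Effectively relatable" means obtainable via local, rule-by-rule transformations. *)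

theory Defs
  imports "HOL-Library.Multiset"
begin

section \<open>Derivations and local transformations\<close>

text \<open>
  A calculus is given by its set of inferences, as a predicate on the list of premises and the
  conclusion.  \<open>Hyp i s\<close> is an open leaf of a derivation: it stands for the \<open>i\<close>-th (from 0) of the
  hypotheses that the derivation starts from, the sequent \<open>s\<close>.
\<close>

datatype 's deriv = Hyp nat 's | Infer "'s deriv list" 's

primrec concl :: "'s deriv \<Rightarrow> 's" where
  "concl (Hyp i s) = s"
| "concl (Infer Ds c) = c"

primrec hyps :: "'s deriv \<Rightarrow> (nat \<times> 's) list" where
  "hyps (Hyp i s) = [(i, s)]"
| "hyps (Infer Ds c) = concat (map hyps Ds)"

fun valid :: "('s list \<Rightarrow> 's \<Rightarrow> bool) \<Rightarrow> 's deriv \<Rightarrow> bool" where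
  "valid K (Hyp i s) \<longleftrightarrow> True"
| "valid K (Infer Ds c) \<longleftrightarrow> K (map concl Ds) c \<and> (\<forall>D\<in>set Ds. valid K D)"

text \<open>
  The open leaves are exactly the sequents in \<open>Ps\<close>, each occurring once.  For \<open>Ps = []\<close> this is a
  derivation in the usual sense.
\<close>

definition derivation :: "('s list \<Rightarrow> 's \<Rightarrow> bool) \<Rightarrow> 's list \<Rightarrow> 's deriv \<Rightarrow> 's \<Rightarrow> bool" where
  "derivation K Ps D c \<longleftrightarrow> valid K D \<and> hyps D = enumerate 0 Ps \<and> concl D = c"

primrec graft :: "'s deriv list \<Rightarrow> 's deriv \<Rightarrow> 's deriv" where
  "graft Es (Hyp i s) = Es ! i"
| "graft Es (Infer Ds c) = Infer (map (graft Es) Ds) c"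

text \<open>
  A local transformation of \<open>K\<close> into \<open>K'\<close>, along a translation \<open>T\<close> of sequents, replaces each single
  inference by an open derivation in \<open>K'\<close> leading from the translated premises to the translated
  conclusion.  The replacement \<open>f Ps c\<close> depends on that inference only, not on the derivations of
  its premises, and is required for all inferences whose conclusion is in \<open>C\<close>, whether
  or not the premises are derivable.
\<close>

definition local_transformation ::
    "('s list \<Rightarrow> 's \<Rightarrow> bool) \<Rightarrow> ('t list \<Rightarrow> 't \<Rightarrow> bool) \<Rightarrow> ('s \<Rightarrow> 't) \<Rightarrow> 's set
      \<Rightarrow> ('s list \<Rightarrow> 's \<Rightarrow> 't deriv) \<Rightarrow> bool" where
  "local_transformation K K' T C f \<longleftrightarrow>
     (\<forall>Ps c. K Ps c \<and> c \<in> C \<longrightarrow> derivation K' (map T Ps) (f Ps c) (T c))"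

primrec transform :: "('s \<Rightarrow> 't) \<Rightarrow> ('s list \<Rightarrow> 's \<Rightarrow> 't deriv) \<Rightarrow> 's deriv \<Rightarrow> 't deriv" where
  "transform T f (Hyp i s) = Hyp i (T s)"
| "transform T f (Infer Ds c) = graft (map (transform T f) Ds) (f (map concl Ds) c)"

definition effectively_relatable ::
    "('s list \<Rightarrow> 's \<Rightarrow> bool) \<Rightarrow> ('t list \<Rightarrow> 't \<Rightarrow> bool) \<Rightarrow> ('s \<Rightarrow> 't) \<Rightarrow> 's set
      \<Rightarrow> 's deriv \<Rightarrow> 't deriv \<Rightarrow> bool" where
  "effectively_relatable K K' T C D E \<longleftrightarrow>
     (\<exists>f. local_transformation K K' T C f \<and> transform T f D = E)"


section \<open>Tense formulae\<close>

datatype 'a form =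
    Atom 'a
  | NAtom 'a
  | And "'a form" "'a form"
  | Or "'a form" "'a form"
  | Box "'a form"
  | Dia "'a form"
  | BBox "'a form"  \<comment> \<open>past box\<close>
  | BDia "'a form"  \<comment> \<open>past diamond\<close>


section \<open>Labeled sequents and G3Kt\<close>

text \<open>
  \<open>(x, y)\<close> in the first component is the relational atom \<open>Rxy\<close>; \<open>(x, A)\<close> in the second is \<open>x : A\<close>.
\<close>

type_synonym ('l, 'a) lseq = "('l \<times> 'l) multiset \<times> ('l \<times> 'a form) multiset"

definition labels :: "('l, 'a) lseq \<Rightarrow> 'l set" where
  "labels S = Field (set_mset (fst S)) \<union> fst ` set_mset (snd S)"

inductive g3kt :: "('l, 'a) lseq list \<Rightarrow> ('l, 'a) lseq \<Rightarrow> bool" where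
  g3kt_id: "g3kt [] (R, \<Gamma> + {#(x, Atom p), (x, NAtom p)#})"
| g3kt_or: "g3kt [(R, \<Gamma> + {#(x, A), (x, B)#})] (R, \<Gamma> + {#(x, Or A B)#})"
| g3kt_and: "g3kt [(R, \<Gamma> + {#(x, A)#}), (R, \<Gamma> + {#(x, B)#})] (R, \<Gamma> + {#(x, And A B)#})"
| g3kt_box: "y \<notin> labels (R, \<Gamma> + {#(x, Box A)#}) \<Longrightarrow>
    g3kt [(R + {#(x, y)#}, \<Gamma> + {#(y, A)#})] (R, \<Gamma> + {#(x, Box A)#})"
| g3kt_dia: "g3kt [(R + {#(x, y)#}, \<Gamma> + {#(y, A), (x, Dia A)#})]
    (R + {#(x, y)#}, \<Gamma> + {#(x, Dia A)#})"
| g3kt_bbox: "y \<notin> labels (R, \<Gamma> + {#(x, BBox A)#}) \<Longrightarrow>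
    g3kt [(R + {#(y, x)#}, \<Gamma> + {#(y, A)#})] (R, \<Gamma> + {#(x, BBox A)#})"
| g3kt_bdia: "g3kt [(R + {#(y, x)#}, \<Gamma> + {#(y, A), (x, BDia A)#})]
    (R + {#(y, x)#}, \<Gamma> + {#(x, BDia A)#})"


section \<open>Polytree sequents\<close>

definition cycle_in :: "('l \<times> 'l) set \<Rightarrow> 'l list \<Rightarrow> bool" where
  "cycle_in A vs \<longleftrightarrow> length vs \<ge> 3 \<and> distinct vs \<and>
     successively (\<lambda>u v. (u, v) \<in> A) vs \<and> (last vs, hd vs) \<in> A"

text \<open>Here \<open>A\<close> is the symmetric and irreflexive adjacency relation of a simple graph.\<close>

definition is_tree :: "'l set \<Rightarrow> ('l \<times> 'l) set \<Rightarrow> bool" where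
  "is_tree V A \<longleftrightarrow> V \<noteq> {} \<and> (\<forall>u\<in>V. \<forall>v\<in>V. (u, v) \<in> A\<^sup>*) \<and> (\<nexists>vs. cycle_in A vs)"

text \<open>
  A polytree is an orientation of a tree.  Asymmetry excludes loops \<open>Rxx\<close> and pairs \<open>Rxy, Ryx\<close>,
  which are cycles in the underlying undirected graph but invisible in the symmetric closure.
  Several copies of one relational atom give a single edge.
\<close>

definition polytree :: "('l, 'a) lseq \<Rightarrow> bool" where
  "polytree S \<longleftrightarrow> (let E = set_mset (fst S) in asym E \<and> is_tree (labels S) (E \<union> E\<inverse>))"


section \<open>Nested sequents and SKT\<close>

text \<open>
  A nested sequent is a multiset of the following items, so the comma is \<open>+\<close> and the empty nested
  sequent is \<open>{#}\<close>.
\<close>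

datatype 'a item = Fm "'a form" | Circ "'a item multiset" | Bullet "'a item multiset"

type_synonym 'a nseq = "'a item multiset"

inductive skt :: "'a nseq list \<Rightarrow> 'a nseq \<Rightarrow> bool" where
  skt_id: "skt [] (X + {#Fm (Atom p), Fm (NAtom p)#})"
| skt_or: "skt [X + {#Fm A, Fm B#}] (X + {#Fm (Or A B)#})"
| skt_and: "skt [X + {#Fm A#}, X + {#Fm B#}] (X + {#Fm (And A B)#})"
| skt_ctr: "skt [X + Y + Y] (X + Y)"
| skt_wk: "skt [X] (X + Y)"
| skt_rf: "skt [X + {#Circ Y#}] ({#Bullet X#} + Y)"
| skt_rp: "skt [X + {#Bullet Y#}] ({#Circ X#} + Y)"
| skt_bbox: "skt [X + {#Bullet {#Fm A#}#}] (X + {#Fm (BBox A)#})"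
| skt_box: "skt [X + {#Circ {#Fm A#}#}] (X + {#Fm (Box A)#})"
| skt_bdia: "skt [X + {#Bullet (Y + {#Fm A#}), Fm (BDia A)#}] (X + {#Bullet Y, Fm (BDia A)#})"
| skt_dia: "skt [X + {#Circ (Y + {#Fm A#}), Fm (Dia A)#}] (X + {#Circ Y, Fm (Dia A)#})"


section \<open>The translation of labeled polytree sequents\<close>

definition detach :: "'l \<Rightarrow> ('l \<times> 'l) multiset \<Rightarrow> ('l \<times> 'l) multiset" where
  "detach x R = filter_mset (\<lambda>(u, v). u \<noteq> x \<and> v \<noteq> x) R"

lemma size_detach:
  assumes "(u, v) \<in># R" "u = x \<or> v = x"
  shows "size (detach x R) < size R"
proof -
  have "detach x R \<subseteq># R" by (simp add: detach_def)
  moreover have "detach x R \<noteq> R" using assms by (auto simp: detach_def filter_mset_eq_conv)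
  ultimately show ?thesis by (simp add: mset_subset_size subset_mset.less_le)
qed

lemma finite_neighbours:
  "finite {y. (x, y) \<in># R}" "finite {z. (z, x) \<in># R}"
proof -
  have "{y. (x, y) \<in># R} \<subseteq> snd ` set_mset R" "{z. (z, x) \<in># R} \<subseteq> fst ` set_mset R" by force+
  then show "finite {y. (x, y) \<in># R}" "finite {z. (z, x) \<in># R}"
    by (auto intro: finite_subset)
qed

text \<open>
  In a polytree, deleting the edges at \<open>x\<close> leaves each neighbour \<open>y\<close> of \<open>x\<close> connected to exactly the
  subtree hanging from \<open>x\<close> at \<open>y\<close>.
\<close>

function nest ::
    "'l \<Rightarrow> ('l \<times> 'l) multiset \<Rightarrow> ('l \<times> 'a form) multiset \<Rightarrow> 'a nseq" where
  "nest x R \<Gamma> =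
     {#Fm A. (w, A) \<in># filter_mset (\<lambda>(w, A). w = x) \<Gamma>#}
     + {#Circ (nest y (detach x R) \<Gamma>). y \<in># mset_set {y. (x, y) \<in># R}#}
     + {#Bullet (nest z (detach x R) \<Gamma>). z \<in># mset_set {z. (z, x) \<in># R}#}"
  by auto
termination
  by (relation "measure (\<lambda>(x, R, \<Gamma>). size R)") (auto simp: finite_neighbours intro: size_detach)

declare nest.simps [simp del]

definition nested_of :: "'l \<Rightarrow> ('l, 'a) lseq \<Rightarrow> 'a nseq" where
  "nested_of x S = nest x (fst S) (snd S)"

end

theory Submission
  imports Defs
begin

text \<open>
  If \<open>x\<close> and \<open>y\<close> are adjacent in a polytree, the translations rooted at \<open>x\<close> and at \<open>y\<close> are
  obtained from each other by one display rule, so any label can be made the root.  Rooted at the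
  label of its principal formula, each labeled inference becomes the nested inference of the same
  name; displaying that label before and the original root after the inference gives the local
  transformation.  Premises of an inference with a polytree conclusion are polytrees, so the
  transformation applies to every inference of the derivation.
\<close>

section \<open>Forests\<close>

definition adj :: "('l \<times> 'l) multiset \<Rightarrow> 'l \<Rightarrow> 'l \<Rightarrow> bool" where
  "adj R u v \<longleftrightarrow> (u, v) \<in># R \<or> (v, u) \<in># R"

text \<open>Such sets are unions of connected components. Using them instead of paths lets one set
  both separate neighbours and bound the part of the graph that \<open>nest\<close> visits.\<close>

definition adj_closed :: "('l \<times> 'l) multiset \<Rightarrow> 'l set \<Rightarrow> bool" where
  "adj_closed R S \<longleftrightarrow> (\<forall>u v. (u, v) \<in># R \<longrightarrow> (u \<in> S \<longleftrightarrow> v \<in> S))"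

text \<open>
  Acyclicity, stated as a separation property: distinct neighbours of \<open>w\<close> lie in different
  components once \<open>w\<close> is deleted.
\<close>

definition forest :: "('l \<times> 'l) multiset \<Rightarrow> bool" where
  "forest R \<longleftrightarrow> asym (set_mset R) \<and>
     (\<forall>w a b. adj R w a \<and> adj R w b \<and> a \<noteq> b \<longrightarrow>
        (\<exists>S. adj_closed (detach w R) S \<and> a \<in> S \<and> b \<notin> S))"

lemma in_detach [simp]: "(u, v) \<in># detach x R \<longleftrightarrow> (u, v) \<in># R \<and> u \<noteq> x \<and> v \<noteq> x"
  by (auto simp: detach_def)

lemma detach_add_mset:
  "detach x (add_mset (u, v) R) = (if u = x \<or> v = x then detach x R else add_mset (u, v) (detach x R))"
  by (auto simp: detach_def)

lemma detach_fresh: "x \<notin> Field (set_mset R) \<Longrightarrow> detach x R = R"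
  unfolding detach_def by (force simp: filter_mset_eq_conv Field_def)

lemma adj_sym: "adj R u v \<longleftrightarrow> adj R v u"
  by (auto simp: adj_def)

lemma adj_closedD: "adj_closed R S \<Longrightarrow> adj R u v \<Longrightarrow> u \<in> S \<longleftrightarrow> v \<in> S"
  by (auto simp: adj_closed_def adj_def)

lemma forest_asymD: "forest R \<Longrightarrow> (u, v) \<in># R \<Longrightarrow> (v, u) \<notin># R"
  by (auto simp: forest_def dest: asymD)

lemma forest_irrefl: "forest R \<Longrightarrow> (u, u) \<notin># R"
  using forest_asymD by metis

lemma forest_separate:
  assumes "forest R" "adj R w a" "adj R w b" "a \<noteq> b"
  obtains S where "adj_closed (detach w R) S" "a \<in> S" "b \<notin> S"
  using assms unfolding forest_def by blast

lemma simple_path: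
  assumes "(a, b) \<in> A\<^sup>*"
  shows "\<exists>vs. vs \<noteq> [] \<and> hd vs = a \<and> last vs = b \<and> distinct vs \<and>
    successively (\<lambda>u v. (u, v) \<in> A) vs"
  using assms
proof (induction rule: converse_rtrancl_induct)
  case base
  show ?case by (rule exI[of _ "[b]"]) simp
next
  case (step a c)
  then obtain vs where vs: "vs \<noteq> []" "hd vs = c" "last vs = b" "distinct vs"
    "successively (\<lambda>u v. (u, v) \<in> A) vs" by blast
  show ?case
  proof (cases "a \<in> set vs")
    \<comment> \<open>Prepending \<open>a\<close> would repeat a vertex, so the stretch of
      \<open>vs\<close> before \<open>a\<close> is cut off instead.\<close>
    case True
    then obtain ps qs where "vs = ps @ a # qs" by (meson split_list)
    then show ?thesis using vs
      by (intro exI[of _ "a # qs"]) (auto simp: successively_append_iff)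
  next
    case False
    then show ?thesis using vs step(1)
      by (intro exI[of _ "a # vs"]) (auto simp: successively_Cons)
  qed
qed

text \<open>The separating set is the component of \<open>a\<close> after deleting \<open>w\<close>.
  If it contained \<open>b\<close>, a simple path from \<open>a\<close> to \<open>b\<close> avoiding
  \<open>w\<close> would close up to a cycle through \<open>w\<close>.\<close>

lemma forest_if_acyclic:
  assumes "asym (set_mset R)" "\<nexists>vs. cycle_in {(u, v). adj R u v} vs"
  shows "forest R"
  unfolding forest_def
proof (intro conjI allI impI)
  fix w a b
  assume ab: "adj R w a \<and> adj R w b \<and> a \<noteq> b"
  let ?A = "{(u, v). adj (detach w R) u v}"
  let ?S = "{v. (a, v) \<in> ?A\<^sup>*}"
  have "b \<notin> ?S"
  proof
    assume "b \<in> ?S"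
    then obtain vs where vs: "vs \<noteq> []" "hd vs = a" "last vs = b" "distinct vs"
      "successively (\<lambda>u v. (u, v) \<in> ?A) vs"
      using simple_path by (metis mem_Collect_eq)
    then obtain c ws where cw: "vs = a # c # ws"
      using ab by (metis last.simps list.collapse)
    \<comment> \<open>The length bound matters: a single vertex lies on no edge and could be
      \<open>w\<close> itself.\<close>
    have "w \<notin> set us" if "successively (\<lambda>u v. (u, v) \<in> ?A) us" "length us \<ge> 2" for us
      using that
    proof (induction us rule: induct_list012)
      case (3 x y zs)
      then show ?case by (cases zs) (auto simp: adj_def)
    qed auto
    from this[OF vs(5)] have w: "w \<notin> set vs" by (simp add: cw)
    have "successively (\<lambda>u v. (u, v) \<in> {(u, v). adj R u v}) vs"
      using vs(5) by (rule successively_mono) (auto simp: adj_def)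
    then have "cycle_in {(u, v). adj R u v} (w # vs)"
      using vs w cw ab by (auto simp: cycle_in_def adj_sym[of R w])
    then show False using assms(2) by blast
  qed
  moreover have "adj_closed (detach w R) ?S"
    unfolding adj_closed_def
  proof (intro allI impI)
    fix u v assume "(u, v) \<in># detach w R"
    then have "(u, v) \<in> ?A" "(v, u) \<in> ?A" by (auto simp: adj_def)
    then show "(u \<in> ?S) = (v \<in> ?S)" by (auto intro: rtrancl_into_rtrancl simp del: in_detach)
  qed
  ultimately show "\<exists>S. adj_closed (detach w R) S \<and> a \<in> S \<and> b \<notin> S" by blast
qed (fact assms(1))

text \<open>Cut the cycle at its first vertex \<open>w\<close>. What remains is a path avoiding
  \<open>w\<close> between two distinct neighbours of \<open>w\<close>, so no closed set separates
  them.\<close>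

lemma forest_acyclic:
  assumes "forest R"
  shows "\<not> cycle_in {(u, v). adj R u v} vs"
proof
  assume c: "cycle_in {(u, v). adj R u v} vs"
  then obtain w a b' us where vs: "vs = w # a # b' # us"
    by (auto simp: cycle_in_def Suc_le_length_iff numeral_3_eq_3)
  define ts where "ts = a # b' # us"
  have ts: "w \<notin> set ts" "distinct ts" "successively (adj R) ts" "adj R w a" "adj R w (last ts)"
    using c by (auto simp: cycle_in_def vs ts_def adj_sym[of R w])
  have "a \<noteq> last ts" using ts(2) by (auto simp: ts_def)
  then obtain S where S: "adj_closed (detach w R) S" "a \<in> S" "last ts \<notin> S"
    using forest_separate[OF assms ts(4,5)] by blast
  have "set zs \<subseteq> S" if "successively (adj R) zs" "w \<notin> set zs" "zs \<noteq> []" "hd zs \<in> S" for zs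
    using that
  proof (induction zs rule: induct_list012)
    case (3 x y zs)
    then have "adj (detach w R) x y" by (auto simp: adj_def)
    then have "y \<in> S" using 3 adj_closedD[OF S(1)] by auto
    then show ?case using 3 by auto
  qed auto
  from this[OF ts(3,1)] have "set ts \<subseteq> S" using S(2) by (simp add: ts_def)
  then show False using S(3) last_in_set[of ts] by (auto simp: ts_def)
qed

lemma forest_add_leaf:
  assumes R: "forest R" and y: "y \<notin> Field (set_mset R)" "u \<noteq> y"
    and e: "e = (u, y) \<or> e = (y, u)"
  shows "forest (add_mset e R)"
  unfolding forest_def
proof (intro conjI allI impI)
  have ny: "(v, y) \<notin># R" "(y, v) \<notin># R" for v
    using y by (auto simp: Field_def)
  show "asym (set_mset (add_mset e R))"
    using e y(2) ny forest_asymD[OF R] by (intro asymI) auto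
  fix w a b
  assume ab: "adj (add_mset e R) w a \<and> adj (add_mset e R) w b \<and> a \<noteq> b"
  \<comment> \<open>The new leaf has a single neighbour, so it cannot have the two distinct
    neighbours \<open>a\<close> and \<open>b\<close>.\<close>
  then have wy: "w \<noteq> y" using e ny y(2) by (auto simp: adj_def)
  consider "a = y" | "b = y" | "a \<noteq> y" "b \<noteq> y" by blast
  then show "\<exists>S. adj_closed (detach w (add_mset e R)) S \<and> a \<in> S \<and> b \<notin> S"
  proof cases
    \<comment> \<open>The only edges at \<open>y\<close> go to \<open>u = w\<close>, and detaching
      \<open>w\<close> isolates \<open>y\<close>; hence \<open>{y}\<close> or its complement
      separates.\<close>
    case 1
    then have "w = u" using ab e ny by (auto simp: adj_def)
    then show ?thesis using 1 ab e ny
      by (intro exI[of _ "{y}"]) (auto simp: adj_closed_def)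
  next
    case 2
    then have "w = u" using ab e ny by (auto simp: adj_def)
    then show ?thesis using 2 ab e ny
      by (intro exI[of _ "- {y}"]) (auto simp: adj_closed_def)
  next
    case 3
    then have "adj R w a" "adj R w b" using ab e wy by (auto simp: adj_def)
    then obtain S where S: "adj_closed (detach w R) S" "a \<in> S" "b \<notin> S"
      using forest_separate[OF R] ab by blast
    \<comment> \<open>The old separating set still works once \<open>y\<close> is put on the side of
      \<open>u\<close>.\<close>
    then show ?thesis using 3 e ny y(2)
      by (intro exI[of _ "if u \<in> S then insert y S else S - {y}"]) (auto simp: adj_closed_def)
  qed
qed

section \<open>Polytrees as connected forests, and their preservation from conclusion to
  premises\<close>

lemma sym_closure_eq_adj: "set_mset R \<union> (set_mset R)\<inverse> = {(u, v). adj R u v}"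
  by (auto simp: adj_def)

lemma adj_rtranclp_sym: "(adj R)\<^sup>*\<^sup>* u v \<Longrightarrow> (adj R)\<^sup>*\<^sup>* v u"
  by (metis adj_sym sympI symp_rtranclp sympD)

text \<open>Separation is what the computation of \<open>nest\<close> needs, and reachability from
  one root extends to a new leaf more easily than connectivity of all pairs.\<close>

lemma polytree_iff:
  "polytree S \<longleftrightarrow> forest (fst S) \<and>
     (\<exists>r\<in>labels S. \<forall>v\<in>labels S. (adj (fst S))\<^sup>*\<^sup>* r v)"
proof -
  let ?A = "{(u, v). adj (fst S) u v}"
  have rt: "(u, v) \<in> ?A\<^sup>* \<longleftrightarrow> (adj (fst S))\<^sup>*\<^sup>* u v" for u v
    by (simp add: rtranclp_rtrancl_eq)
  have f: "asym (set_mset (fst S)) \<and> (\<nexists>vs. cycle_in ?A vs) \<longleftrightarrow> forest (fst S)"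
    using forest_if_acyclic[of "fst S"] forest_acyclic[of "fst S"] forest_def[of "fst S"] by blast
  have c: "labels S \<noteq> {} \<and> (\<forall>u\<in>labels S. \<forall>v\<in>labels S. (adj (fst S))\<^sup>*\<^sup>* u v) \<longleftrightarrow>
      (\<exists>r\<in>labels S. \<forall>v\<in>labels S. (adj (fst S))\<^sup>*\<^sup>* r v)" (is "?L \<longleftrightarrow> ?R")
  proof
    assume ?R
    then show ?L using adj_rtranclp_sym[of "fst S"] rtranclp_trans[of "adj (fst S)"] by blast
  qed blast
  show ?thesis
    unfolding polytree_def Let_def is_tree_def sym_closure_eq_adj rt f[symmetric] c[symmetric]
    by argo
qed

lemma polytree_connected:
  assumes "polytree S" "u \<in> labels S" "v \<in> labels S"
  shows "(adj (fst S))\<^sup>*\<^sup>* u v"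
  using assms by (meson adj_rtranclp_sym polytree_iff rtranclp_trans)

lemma adj_rtranclp_add_mset: "(adj R)\<^sup>*\<^sup>* u v \<Longrightarrow> (adj (add_mset e R))\<^sup>*\<^sup>* u v"
  by (erule rtranclp_mono[THEN predicate2D, rotated]) (auto simp: adj_def)

lemma polytree_cong:
  "fst S = fst S' \<Longrightarrow> labels S = labels S' \<Longrightarrow> polytree S \<longleftrightarrow> polytree S'"
  by (simp add: polytree_def)

text \<open>Serves both box rules read upwards: the fresh label becomes a leaf at the principal
  label.\<close>

lemma polytree_add_leaf:
  assumes S: "polytree S" and y: "y \<notin> labels S" and u: "u \<in> labels S"
    and e: "e = (u, y) \<or> e = (y, u)"
    and S': "fst S' = add_mset e (fst S)" "labels S' = insert y (labels S)"
  shows "polytree S'"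
proof -
  have "forest (fst S')"
    unfolding S' using S y u e
    by (intro forest_add_leaf[of _ y u]) (auto simp: polytree_iff labels_def)
  moreover have "(adj (fst S'))\<^sup>*\<^sup>* u v" if "v \<in> labels S'" for v
    using that S' e polytree_connected[OF S u] adj_rtranclp_add_mset[of "fst S" u v e]
    by (auto simp: adj_def)
  ultimately show ?thesis using u S' by (auto simp: polytree_iff)
qed

text \<open>Read upwards, the box rules add a leaf and all other rules keep graph and labels. The
  inclusion of labels keeps a root chosen for the conclusion available in the premises.\<close>

lemma g3kt_premise_polytree:
  assumes "g3kt Ps c" "polytree c" "P \<in> set Ps"
  shows "polytree P \<and> labels c \<subseteq> labels P"
  using assms
proof cases
  case (g3kt_or R \<Gamma> x A B)
  then have "labels P = labels c" "fst P = fst c" using assms(3) by (auto simp: labels_def)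
  then show ?thesis using assms(2) polytree_cong by blast
next
  case (g3kt_and R \<Gamma> x A B)
  then have "labels P = labels c" "fst P = fst c" using assms(3) by (auto simp: labels_def)
  then show ?thesis using assms(2) polytree_cong by blast
next
  case (g3kt_box y R \<Gamma> x A)
  then have "labels P = insert y (labels c)" "fst P = add_mset (x, y) (fst c)" "x \<in> labels c"
    using assms(3) by (auto simp: labels_def)
  then show ?thesis using polytree_add_leaf[OF assms(2)] g3kt_box by blast
next
  case (g3kt_dia R x y \<Gamma> A)
  then have "labels P = labels c" "fst P = fst c" using assms(3) by (auto simp: labels_def)
  then show ?thesis using assms(2) polytree_cong by blast
next
  case (g3kt_bbox y R \<Gamma> x A)
  then have "labels P = insert y (labels c)" "fst P = add_mset (y, x) (fst c)" "x \<in> labels c"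
    using assms(3) by (auto simp: labels_def)
  then show ?thesis using polytree_add_leaf[OF assms(2)] g3kt_bbox by blast
next
  case (g3kt_bdia R y x \<Gamma> A)
  then have "labels P = labels c" "fst P = fst c" using assms(3) by (auto simp: labels_def)
  then show ?thesis using assms(2) polytree_cong by blast
qed simp

section \<open>Computing the nested translation\<close>

text \<open>The recursion started at \<open>x\<close> never leaves \<open>S\<close>. For edges only
  membership counts, since \<open>nest\<close> collects neighbours as sets; for formulae
  multiplicities count.\<close>

lemma nest_cong:
  assumes "x \<in> S" "adj_closed R S"
    and "\<And>u v. u \<in> S \<or> v \<in> S \<Longrightarrow> (u, v) \<in># R \<longleftrightarrow> (u, v) \<in># R'"
    and "filter_mset (\<lambda>(w, A). w \<in> S) \<Gamma> = filter_mset (\<lambda>(w, A). w \<in> S) \<Gamma>'"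
  shows "nest x R \<Gamma> = nest x R' \<Gamma>'"
  using assms
proof (induction x R \<Gamma> arbitrary: R' rule: nest.induct)
  case (1 x R \<Gamma>)
  have cl: "adj_closed (detach x R) S" using 1(4) by (auto simp: adj_closed_def)
  have eq: "(u, v) \<in># detach x R \<longleftrightarrow> (u, v) \<in># detach x R'" if "u \<in> S \<or> v \<in> S" for u v
    using 1(5) that by auto
  \<comment> \<open>The formulae at the root survive the restriction to \<open>S\<close>, so they
    can be read off the part on which \<open>\<Gamma>\<close> and \<open>\<Gamma>'\<close>
    agree.\<close>
  have sub: "filter_mset (\<lambda>(w, A). w = x) \<Delta> =
      filter_mset (\<lambda>(w, A). w = x) (filter_mset (\<lambda>(w, A). w \<in> S) \<Delta>)"
    for \<Delta> :: "('a \<times> 'b form) multiset"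
    unfolding filter_filter_mset using 1(3) by (intro filter_mset_cong) auto
  have fs: "{y. (x, y) \<in># R'} = {y. (x, y) \<in># R}" "{z. (z, x) \<in># R'} = {z. (z, x) \<in># R}"
    using 1(3,5) by auto
  have c: "nest y (detach x R) \<Gamma> = nest y (detach x R') \<Gamma>'"
    if "y \<in># mset_set {y. (x, y) \<in># R}" for y
  proof (rule "1.IH"(1)[OF that _ cl eq 1(6)])
    show "y \<in> S" using that 1(3,4) by (auto simp: finite_neighbours adj_closed_def)
  qed
  have b: "nest z (detach x R) \<Gamma> = nest z (detach x R') \<Gamma>'"
    if "z \<in># mset_set {z. (z, x) \<in># R}" for z
  proof (rule "1.IH"(2)[OF that _ cl eq 1(6)])
    show "z \<in> S" using that 1(3,4) by (auto simp: finite_neighbours adj_closed_def)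
  qed
  show ?case
    unfolding nest.simps[of x R] nest.simps[of x R'] fs sub[of \<Gamma>] sub[of \<Gamma>'] 1(6)
    using c b by (simp cong: image_mset_cong)
qed

lemma nest_add_other:
  assumes "y \<notin> Field (set_mset R)" "x \<noteq> y"
  shows "nest x R (add_mset (y, A) \<Gamma>) = nest x R \<Gamma>"
  using assms by (intro nest_cong[of _ "- {y}"]) (auto simp: adj_closed_def Field_def)

text \<open>The branches are computed in \<open>detach x R\<close>, where \<open>x\<close> is
  isolated. A loop at \<open>x\<close> would make \<open>x\<close> a branch of itself and duplicate
  the formula.\<close>

lemma nest_add_root:
  assumes "(x, x) \<notin># R"
  shows "nest x R (add_mset (x, A) \<Gamma>) = add_mset (Fm A) (nest x R \<Gamma>)"
proof -
  have "nest y (detach x R) (add_mset (x, A) \<Gamma>) = nest y (detach x R) \<Gamma>"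
    if "(x, y) \<in># R \<or> (y, x) \<in># R" for y
    using that assms by (intro nest_add_other) (auto simp: Field_def)
  then show ?thesis
    unfolding nest.simps[of x R] by (simp add: finite_neighbours)
      (intro arg_cong2[of _ _ _ _ "(+)"] image_mset_cong; simp add: finite_neighbours)
qed

lemma nest_isolated:
  assumes "y \<notin> Field (set_mset R)" "y \<notin> fst ` set_mset \<Gamma>"
  shows "nest y R \<Gamma> = {#}"
proof -
  have "filter_mset (\<lambda>(w, A). w = y) \<Gamma> = {#}" using assms(2) by (force simp: filter_mset_eq_mempty_iff)
  moreover have "{v. (y, v) \<in># R} = {}" "{v. (v, y) \<in># R} = {}"
    using assms(1) by (auto simp: Field_def)
  ultimately show ?thesis by (simp add: nest.simps[of y R])
qed

text \<open>The branch at \<open>z\<close> lies in a component of \<open>detach x R\<close> that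
  misses \<open>y\<close>, so deleting the edges at \<open>y\<close> does not affect it. This is
  where the separation property enters.\<close>

lemma nest_detach_sibling:
  assumes "forest R" "adj R x y" "adj R x z" "z \<noteq> y"
  shows "nest z (detach x (detach y R)) \<Gamma> = nest z (detach x R) \<Gamma>"
proof -
  obtain S where S: "adj_closed (detach x R) S" "z \<in> S" "y \<notin> S"
    using forest_separate[OF assms(1,3,2,4)] .
  show ?thesis using S by (intro nest_cong[of _ S]) (auto simp: adj_closed_def)
qed

text \<open>Cuts the tree at one edge into the part at \<open>x\<close> and the part at
  \<open>y\<close>. Neither part depends on which end is the root, so the split at \<open>y\<close>
  has the same two parts with \<open>Bullet\<close> in place of \<open>Circ\<close>.\<close>

lemma nest_split_circ:
  assumes R: "forest R" and e: "(x, y) \<in># R"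
  shows "nest x R \<Gamma> = nest x (detach y R) \<Gamma> + {#Circ (nest y (detach x R) \<Gamma>)#}"
proof -
  have xy: "x \<noteq> y" using R e forest_irrefl by metis
  have a: "adj R x y" using e by (simp add: adj_def)
  have c: "{z. (x, z) \<in># R} = insert y {z. (x, z) \<in># detach y R}" using e xy by auto
  \<comment> \<open>By asymmetry \<open>y\<close> is not also an in-neighbour of \<open>x\<close>,
    so its branch occurs only once.\<close>
  have b: "{z. (z, x) \<in># R} = {z. (z, x) \<in># detach y R}"
    using xy forest_asymD[OF R e] by auto
  have "nest z (detach x (detach y R)) \<Gamma> = nest z (detach x R) \<Gamma>"
    if "(x, z) \<in># detach y R \<or> (z, x) \<in># detach y R" for z
    using that by (intro nest_detach_sibling[OF R a]) (auto simp: adj_def)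
  moreover have "(x, y) \<notin># detach y R" "(y, x) \<notin># detach y R" by simp_all
  ultimately show ?thesis
    unfolding nest.simps[of x R] nest.simps[of x "detach y R"] c b
    by (simp add: finite_neighbours del: in_detach)
      (intro arg_cong2[of _ _ _ _ "(+)"] image_mset_cong; simp add: finite_neighbours del: in_detach)
qed

lemma nest_split_bullet:
  assumes R: "forest R" and e: "(y, x) \<in># R"
  shows "nest x R \<Gamma> = nest x (detach y R) \<Gamma> + {#Bullet (nest y (detach x R) \<Gamma>)#}"
proof -
  have xy: "x \<noteq> y" using R e forest_irrefl by metis
  have a: "adj R x y" using e by (simp add: adj_def)
  have c: "{z. (z, x) \<in># R} = insert y {z. (z, x) \<in># detach y R}" using e xy by auto
  have b: "{z. (x, z) \<in># R} = {z. (x, z) \<in># detach y R}"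
    using xy forest_asymD[OF R e] by auto
  have "nest z (detach x (detach y R)) \<Gamma> = nest z (detach x R) \<Gamma>"
    if "(x, z) \<in># detach y R \<or> (z, x) \<in># detach y R" for z
    using that by (intro nest_detach_sibling[OF R a]) (auto simp: adj_def)
  moreover have "(x, y) \<notin># detach y R" "(y, x) \<notin># detach y R" by simp_all
  ultimately show ?thesis
    unfolding nest.simps[of x R] nest.simps[of x "detach y R"] c b
    by (simp add: finite_neighbours del: in_detach)
      (intro arg_cong2[of _ _ _ _ "(+)"] image_mset_cong; simp add: finite_neighbours del: in_detach)
qed

section \<open>Changing the root by display rules\<close>

abbreviation skt1 :: "'a nseq \<Rightarrow> 'a nseq \<Rightarrow> bool" where
  "skt1 X Y \<equiv> skt [X] Y"

text \<open>Both roots split along their common edge into the same two parts, and a display rule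
  exchanges their roles.\<close>

lemma nest_display_step:
  assumes R: "forest R" and "adj R x y"
  shows "skt1 (nest x R \<Gamma>) (nest y R \<Gamma>)"
  using assms(2) unfolding adj_def
proof
  assume e: "(x, y) \<in># R"
  show ?thesis
    unfolding nest_split_circ[OF R e] nest_split_bullet[OF R e]
    by (subst (2) add.commute) (rule skt_rf)
next
  assume e: "(y, x) \<in># R"
  show ?thesis
    unfolding nest_split_circ[OF R e] nest_split_bullet[OF R e]
    by (subst (2) add.commute) (rule skt_rp)
qed

lemma nest_display:
  assumes "forest R" "(adj R)\<^sup>*\<^sup>* x y"
  shows "skt1\<^sup>*\<^sup>* (nest x R \<Gamma>) (nest y R \<Gamma>)"
  using assms(2) by induction (auto intro: rtranclp.rtrancl_into_rtrancl nest_display_step[OF assms(1)])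

lemma nested_of_display:
  assumes "polytree S" "x \<in> labels S" "y \<in> labels S"
  shows "skt1\<^sup>*\<^sup>* (nested_of x S) (nested_of y S)"
  unfolding nested_of_def
  using assms by (intro nest_display polytree_connected) (simp_all add: polytree_iff)

section \<open>Local transformations\<close>

lemma valid_extend:
  assumes "skt1\<^sup>*\<^sup>* X Y" "valid skt D" "concl D = X"
  shows "\<exists>D'. valid skt D' \<and> hyps D' = hyps D \<and> concl D' = Y"
  using assms(1)
proof induction
  case base
  then show ?case using assms by blast
next
  case (step Y Z)
  then obtain D' where "valid skt D'" "hyps D' = hyps D" "concl D' = Y" by blast
  then show ?case using step(2) by (intro exI[of _ "Infer [D'] Z"]) simp
qed

text \<open>Display steps are stacked between each leaf and its premise, and below the conclusion.
  Being unary, they leave the list of leaves unchanged.\<close>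

lemma derivation_between:
  assumes "skt Qs d" "list_all2 skt1\<^sup>*\<^sup>* Ps Qs" "skt1\<^sup>*\<^sup>* d c"
  shows "\<exists>D. derivation skt Ps D c"
proof -
  \<comment> \<open>The numbering starts at an arbitrary \<open>n\<close>, because the tail of the
    list is numbered from \<open>Suc n\<close>.\<close>
  have "\<exists>Ds. map concl Ds = Qs \<and> (\<forall>D\<in>set Ds. valid skt D) \<and>
      concat (map hyps Ds) = enumerate n Ps" for n
    using assms(2)
  proof (induction arbitrary: n rule: list_all2_induct)
    case (Cons P Ps Q Qs)
    obtain D where "valid skt D" "hyps D = [(n, P)]" "concl D = Q"
      using valid_extend[OF Cons(1), of "Hyp n P"] by auto
    moreover obtain Ds where "map concl Ds = Qs" "\<forall>D\<in>set Ds. valid skt D"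
      "concat (map hyps Ds) = enumerate (Suc n) Ps" using Cons(3) by blast
    ultimately show ?case by (intro exI[of _ "D # Ds"]) simp
  qed simp
  then obtain Ds where "map concl Ds = Qs" "\<forall>D\<in>set Ds. valid skt D"
    "concat (map hyps Ds) = enumerate 0 Ps" by blast
  then show ?thesis
    using valid_extend[OF assms(3), of "Infer Ds d"] assms(1) by (auto simp: derivation_def)
qed

section \<open>Simulation of a single labeled inference\<close>

lemma g3kt_root_inference:
  assumes "g3kt Ps c" "polytree c"
  shows "\<exists>u\<in>labels c. skt (map (nested_of u) Ps) (nested_of u c)"
proof -
  have fc: "forest (fst c)" using assms(2) by (simp add: polytree_iff)
  have fP: "forest (fst P)" if "P \<in> set Ps" for P
    using g3kt_premise_polytree[OF assms that] by (simp add: polytree_iff)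
  show ?thesis
    using assms(1)
  proof cases
    case (g3kt_id R \<Gamma> x p)
    then have "(x, x) \<notin># R" using fc forest_irrefl[of R x] by simp
    then show ?thesis
      using g3kt_id skt_id[of "nest x R \<Gamma>" p]
      by (intro bexI[of _ x]) (auto simp: nested_of_def labels_def nest_add_root)
  next
    case (g3kt_or R \<Gamma> x A B)
    then have "(x, x) \<notin># R" using fc forest_irrefl[of R x] by simp
    then show ?thesis
      using g3kt_or skt_or[of "nest x R \<Gamma>" A B]
      by (intro bexI[of _ x]) (auto simp: nested_of_def labels_def nest_add_root)
  next
    case (g3kt_and R \<Gamma> x A B)
    then have "(x, x) \<notin># R" using fc forest_irrefl[of R x] by simp
    then show ?thesis
      using g3kt_and skt_and[of "nest x R \<Gamma>" A B]
      by (intro bexI[of _ x]) (auto simp: nested_of_def labels_def nest_add_root)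
  next
    case (g3kt_box y R \<Gamma> x A)
    let ?R = "add_mset (x, y) R"
    have xR: "(x, x) \<notin># R" using fc g3kt_box forest_irrefl[of R x] by simp
    have f: "forest ?R" using fP g3kt_box by auto
    have y: "x \<noteq> y" "y \<notin> Field (set_mset R)" "y \<notin> Field (set_mset (detach x R))"
      "y \<notin> fst ` set_mset \<Gamma>" "(y, y) \<notin># detach x R"
      using g3kt_box(3) by (auto simp: labels_def Field_def)
    \<comment> \<open>Since \<open>y\<close> is fresh, its branch consists of \<open>A\<close>
      alone, and cutting it off gives back the tree of the conclusion.\<close>
    have "nest x ?R (add_mset (y, A) \<Gamma>) = nest x R \<Gamma> + {#Circ {#Fm A#}#}"
      using nest_split_circ[OF f, of x y "add_mset (y, A) \<Gamma>"] y
      by (simp add: detach_add_mset detach_fresh nest_add_other nest_add_root nest_isolated)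
    then show ?thesis
      using g3kt_box xR skt_box[of "nest x R \<Gamma>" A]
      by (intro bexI[of _ x]) (auto simp: nested_of_def labels_def nest_add_root)
  next
    case (g3kt_bbox y R \<Gamma> x A)
    let ?R = "add_mset (y, x) R"
    have xR: "(x, x) \<notin># R" using fc g3kt_bbox forest_irrefl[of R x] by simp
    have f: "forest ?R" using fP g3kt_bbox by auto
    have y: "x \<noteq> y" "y \<notin> Field (set_mset R)" "y \<notin> Field (set_mset (detach x R))"
      "y \<notin> fst ` set_mset \<Gamma>" "(y, y) \<notin># detach x R"
      using g3kt_bbox(3) by (auto simp: labels_def Field_def)
    have "nest x ?R (add_mset (y, A) \<Gamma>) = nest x R \<Gamma> + {#Bullet {#Fm A#}#}"
      using nest_split_bullet[OF f, of y x "add_mset (y, A) \<Gamma>"] y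
      by (simp add: detach_add_mset detach_fresh nest_add_other nest_add_root nest_isolated)
    then show ?thesis
      using g3kt_bbox xR skt_bbox[of "nest x R \<Gamma>" A]
      by (intro bexI[of _ x]) (auto simp: nested_of_def labels_def nest_add_root)
  next
    case (g3kt_dia R x y \<Gamma> A)
    let ?R = "add_mset (x, y) R"
    have f: "forest ?R" using fc g3kt_dia by auto
    have y: "x \<noteq> y" "(x, x) \<notin># ?R" "(y, y) \<notin># detach x ?R" "y \<notin> Field (set_mset (detach y ?R))"
      using forest_irrefl[OF f] by (force simp: Field_def)+
    \<comment> \<open>After the split at the edge to \<open>y\<close>, the extra formula is visible
      only in the branch: in \<open>detach y ?R\<close> the label \<open>y\<close> is
      isolated.\<close>
    have "nest x ?R (add_mset (y, A) \<Gamma>) =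
        nest x (detach y ?R) \<Gamma> + {#Circ (nest y (detach x ?R) \<Gamma> + {#Fm A#})#}"
      using nest_split_circ[OF f, of x y "add_mset (y, A) \<Gamma>"] y by (simp add: nest_add_other nest_add_root)
    moreover have "nest x ?R \<Gamma> = nest x (detach y ?R) \<Gamma> + {#Circ (nest y (detach x ?R) \<Gamma>)#}"
      using nest_split_circ[OF f, of x y \<Gamma>] by simp
    ultimately show ?thesis
      using g3kt_dia y skt_dia[of "nest x (detach y ?R) \<Gamma>" "nest y (detach x ?R) \<Gamma>" A]
      by (intro bexI[of _ x])
        (auto simp: nested_of_def labels_def nest_add_root add_mset_commute[of "(y, A)"]
          add_mset_commute[of "Fm (Dia A)"])
  next
    case (g3kt_bdia R y x \<Gamma> A)
    let ?R = "add_mset (y, x) R"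
    have f: "forest ?R" using fc g3kt_bdia by auto
    have y: "x \<noteq> y" "(x, x) \<notin># ?R" "(y, y) \<notin># detach x ?R" "y \<notin> Field (set_mset (detach y ?R))"
      using forest_irrefl[OF f] by (force simp: Field_def)+
    have "nest x ?R (add_mset (y, A) \<Gamma>) =
        nest x (detach y ?R) \<Gamma> + {#Bullet (nest y (detach x ?R) \<Gamma> + {#Fm A#})#}"
      using nest_split_bullet[OF f, of y x "add_mset (y, A) \<Gamma>"] y by (simp add: nest_add_other nest_add_root)
    moreover have "nest x ?R \<Gamma> = nest x (detach y ?R) \<Gamma> + {#Bullet (nest y (detach x ?R) \<Gamma>)#}"
      using nest_split_bullet[OF f, of y x \<Gamma>] by simp
    ultimately show ?thesis
      using g3kt_bdia y skt_bdia[of "nest x (detach y ?R) \<Gamma>" "nest y (detach x ?R) \<Gamma>" A]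
      by (intro bexI[of _ x])
        (auto simp: nested_of_def labels_def nest_add_root add_mset_commute[of "(y, A)"]
          add_mset_commute[of "Fm (BDia A)"])
  qed
qed

lemma g3kt_inference_simulation:
  assumes "g3kt Ps c" "polytree c" "x \<in> labels c"
  shows "\<exists>D. derivation skt (map (nested_of x) Ps) D (nested_of x c)"
proof -
  obtain u where u: "u \<in> labels c" "skt (map (nested_of u) Ps) (nested_of u c)"
    using g3kt_root_inference[OF assms(1,2)] by blast
  have "skt1\<^sup>*\<^sup>* (nested_of x P) (nested_of u P)" if "P \<in> set Ps" for P
    using g3kt_premise_polytree[OF assms(1,2) that] assms(3) u(1)
    by (intro nested_of_display) auto
  then have "list_all2 skt1\<^sup>*\<^sup>* (map (nested_of x) Ps) (map (nested_of u) Ps)"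
    by (simp add: list.rel_map list_all2_same)
  then show ?thesis
    using derivation_between[OF u(2)] nested_of_display[OF assms(2) u(1) assms(3)] by blast
qed

section \<open>Composing the replacements along a whole derivation\<close>

lemma graft_closed:
  assumes "valid K D"
    and "\<forall>(i, s)\<in>set (hyps D). derivation K [] (Es ! i) s"
  shows "derivation K [] (graft Es D) (concl D)"
  using assms
proof (induction D)
  case (Infer Ds c)
  then have "derivation K [] (graft Es D) (concl D)" if "D \<in> set Ds" for D
    using that by auto
  then show ?case using Infer(2) by (auto simp: derivation_def comp_def cong: map_cong)
qed (simp add: derivation_def)

text \<open>Closure of \<open>C\<close> under premises makes the replacement available at every
  inference of \<open>D\<close>, from the root upwards. The argument is independent of the two
  calculi.\<close>

lemma transform_derivation:
  assumes f: "local_transformation K K' T C f"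
    and C: "\<And>Ps c P. K Ps c \<Longrightarrow> c \<in> C \<Longrightarrow> P \<in> set Ps \<Longrightarrow> P \<in> C"
    and D: "derivation K [] D c" and c: "c \<in> C"
  shows "derivation K' [] (transform T f D) (T c)"
  using D c
proof (induction D arbitrary: c)
  case (Hyp i s)
  then show ?case by (simp add: derivation_def)
next
  case (Infer Ds d)
  then have d: "d = c" "K (map concl Ds) c" "\<forall>D\<in>set Ds. valid K D \<and> hyps D = []"
    by (auto simp: derivation_def)
  have IH: "derivation K' [] (transform T f D) (T (concl D))" if "D \<in> set Ds" for D
    using that d C[OF d(2) Infer(3)] by (intro Infer(1)) (auto simp: derivation_def)
  have F: "derivation K' (map T (map concl Ds)) (f (map concl Ds) c) (T c)"
    using f d(2) Infer(3) unfolding local_transformation_def by blast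
  \<comment> \<open>The leaf numbered \<open>i\<close> carries the translated conclusion of
    \<open>Ds ! i\<close>, which is what the \<open>i\<close>-th grafted derivation proves.\<close>
  have "derivation K' [] (graft (map (transform T f) Ds) (f (map concl Ds) c))
      (concl (f (map concl Ds) c))"
    using F IH by (intro graft_closed) (auto simp: derivation_def in_set_enumerate_eq)
  then show ?case using F d(1) by (simp add: derivation_def)
qed

theorem theorem5p4:
  fixes R :: "('l \<times> 'l) multiset"
    and \<Gamma> :: "('l \<times> 'a form) multiset"
    and D :: "('l, 'a) lseq deriv"
    and x :: 'l
  assumes "polytree (R, \<Gamma>)"
    and "derivation g3kt [] D (R, \<Gamma>)"
    and "x \<in> labels (R, \<Gamma>)"
  shows "\<exists>E. derivation skt [] E (nested_of x (R, \<Gamma>)) \<and>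
    effectively_relatable g3kt skt (nested_of x) {S. polytree S \<and> x \<in> labels S} D E"
proof -
  let ?C = "{S :: ('l, 'a) lseq. polytree S \<and> x \<in> labels S}"
  \<comment> \<open>The choice sees only the inference \<open>Ps\<close>, \<open>c\<close> and the
    fixed root \<open>x\<close>, never \<open>D\<close>; this makes it local.\<close>
  let ?f = "\<lambda>Ps c. SOME E. derivation skt (map (nested_of x) Ps) E (nested_of x c)"
  have f: "local_transformation g3kt skt (nested_of x) ?C ?f"
    unfolding local_transformation_def
  proof (intro allI impI)
    fix Ps and c :: "('l, 'a) lseq"
    assume "g3kt Ps c \<and> c \<in> ?C"
    then have "\<exists>E. derivation skt (map (nested_of x) Ps) E (nested_of x c)"
      by (simp add: g3kt_inference_simulation)
    then show "derivation skt (map (nested_of x) Ps) (?f Ps c) (nested_of x c)"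
      by (rule someI_ex)
  qed
  have closed: "P \<in> ?C" if "g3kt Ps c" "c \<in> ?C" "P \<in> set Ps" for Ps c P
    using that g3kt_premise_polytree[of Ps c P] by auto
  have "derivation skt [] (transform (nested_of x) ?f D) (nested_of x (R, \<Gamma>))"
    by (rule transform_derivation[OF f closed assms(2)]) (use assms(1,3) in simp_all)
  moreover have "effectively_relatable g3kt skt (nested_of x) ?C D (transform (nested_of x) ?f D)"
    unfolding effectively_relatable_def by (intro exI[of _ ?f] conjI f refl)
  ultimately show ?thesis by (intro exI conjI)
qed

end
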